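(* Let $m,n\geq 3$, let $C_m^-$ and $C_n^-$ be two unbalanced signed cycles on $m$ and $n$ vertices respectively, and let $C_m^-\Box C_n^-$ be their Cartesian product. Then $$\operatorname{bdim}(C_m^-\Box C_n^-)=\begin{cases}2, & \text{if } m,n>3,\\ 3, & \text{otherwise}.\end{cases}$$
   Context: A signed graph $\Sigma=(G,\sigma)$ is a graph $G=(V,E)$ with a function $\sigma:E\to\{+1,-1\}$. The sign of a cycle is the product of the signs of its edges; $\Sigma$ is balanced if it has no cycle of sign $-1$. An unbalanced signed cycle $C_m^-$ is a signed graph whose underlying graph is the cycle on $m$ vertices and whose product of edge signs is $-1$. Let $\Omega=\{-1,0,1\}$, with $\Omega^k\subset\mathbb{R}^k$ carrying the standard inner product $\langle\cdot,\cdot\rangle$. A vector valued switching function ($k$-switching function) for $\Sigma$ is a map $\zeta:V\to\Omega^k$ with $\langle\zeta(u),\zeta(v)\rangle\neq 0$ for every edge $uv\in E$; the switched signed graph $\Sigma^\zeta=(G,\sigma^\zeta)$ has $\sigma^\zeta(uv)=\sigma(uv)\operatorname{sgn}(\langle\zeta(u),\zeta(v)\rangle)$. The balancing dimension $\operatorname{bdim}(\Sigma)$ is the least integer $k\ge 1$ for which there is a $k$-switching function $\zeta:V\to\Omega^k$ such that $\Sigma^\zeta$ is all-positive (every edge has sign $+1$). The Cartesian product $\Sigma_1\Box\Sigma_2$ of $\Sigma_1=(G_1,\sigma_1)$ and $\Sigma_2=(G_2,\sigma_2)$ is the Cartesian product $G_1\Box G_2$ of the underlying graphs, with signature $\sigma((u_i,v_j)(u_k,v_l))=\sigma_1(u_iu_k)$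 if $j=l$, and $=\sigma_2(v_jv_l)$ if $i=k$. *)

theory Defs
  imports Complex_Main "Jordan_Normal_Form.Matrix"
begin

record 'a sgraph =
  verts :: "'a set"
  edges :: "'a set set"
  esign :: "'a set \<Rightarrow> real"

text \<open>Graphs are simple: an edge is a two-element set of vertices. The values of
  the signature outside the edge set are irrelevant.\<close>

definition signed_graph :: "'a sgraph \<Rightarrow> bool" where
  "signed_graph \<Sigma> \<longleftrightarrow>
     edges \<Sigma> \<subseteq> {{u, v} | u v. u \<in> verts \<Sigma> \<and> v \<in> verts \<Sigma> \<and> u \<noteq> v} \<and>
     (\<forall>e\<in>edges \<Sigma>. esign \<Sigma> e \<in> {1, -1})"

definition is_cycle_graph :: "nat \<Rightarrow> 'a set \<Rightarrow> 'a set set \<Rightarrow> bool" where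
  "is_cycle_graph m V E \<longleftrightarrow>
     (\<exists>c. bij_betw c {..<m} V \<and> E = {{c i, c (Suc i mod m)} | i. i < m})"

definition unbalanced_signed_cycle :: "nat \<Rightarrow> 'a sgraph \<Rightarrow> bool" where
  "unbalanced_signed_cycle m \<Sigma> \<longleftrightarrow>
     signed_graph \<Sigma> \<and> is_cycle_graph m (verts \<Sigma>) (edges \<Sigma>) \<and>
     (\<Prod>e\<in>edges \<Sigma>. esign \<Sigma> e) = -1"

definition all_positive :: "'a sgraph \<Rightarrow> bool" where
  "all_positive \<Sigma> \<longleftrightarrow> (\<forall>e\<in>edges \<Sigma>. esign \<Sigma> e = 1)"

definition Omega :: "nat \<Rightarrow> real vec set" where
  "Omega k = {x \<in> carrier_vec k. \<forall>i<k. x $ i \<in> {-1, 0, 1}}"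

definition switching_function :: "nat \<Rightarrow> 'a sgraph \<Rightarrow> ('a \<Rightarrow> real vec) \<Rightarrow> bool" where
  "switching_function k \<Sigma> \<zeta> \<longleftrightarrow>
     (\<forall>v\<in>verts \<Sigma>. \<zeta> v \<in> Omega k) \<and>
     (\<forall>u v. {u, v} \<in> edges \<Sigma> \<longrightarrow> \<zeta> u \<bullet> \<zeta> v \<noteq> 0)"

text \<open>The inner product of the vectors at the two ends of an edge. It is well defined
  because the inner product is symmetric; see \<open>edge_inner_eq\<close>.\<close>

definition edge_inner :: "('a \<Rightarrow> real vec) \<Rightarrow> 'a set \<Rightarrow> real" where
  "edge_inner \<zeta> e = (THE c. \<exists>u v. e = {u, v} \<and> c = \<zeta> u \<bullet> \<zeta> v)"

lemma edge_inner_eq: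
  assumes "\<zeta> u \<in> carrier_vec k" "\<zeta> v \<in> carrier_vec k"
  shows "edge_inner \<zeta> {u, v} = \<zeta> u \<bullet> \<zeta> v"
  unfolding edge_inner_def
  using comm_scalar_prod[OF assms] by (intro the_equality) (auto simp: doubleton_eq_iff)

definition switched :: "'a sgraph \<Rightarrow> ('a \<Rightarrow> real vec) \<Rightarrow> 'a sgraph" where
  "switched \<Sigma> \<zeta> = \<Sigma>\<lparr>esign := \<lambda>e. esign \<Sigma> e * sgn (edge_inner \<zeta> e)\<rparr>"

definition bdim :: "'a sgraph \<Rightarrow> nat" where
  "bdim \<Sigma> = (LEAST k. k \<ge> 1 \<and>
     (\<exists>\<zeta>. switching_function k \<Sigma> \<zeta> \<and> all_positive (switched \<Sigma> \<zeta>)))"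

text \<open>An edge of the Cartesian product either has a constant second coordinate, and then
  its first coordinates form an edge of the first factor, or the other way round. Its sign
  is that of its image under the corresponding projection; see \<open>esign_sprod\<close>.\<close>

definition sprod :: "'a sgraph \<Rightarrow> 'b sgraph \<Rightarrow> ('a \<times> 'b) sgraph" (infixr "\<box>" 75) where
  "\<Sigma>\<^sub>1 \<box> \<Sigma>\<^sub>2 = \<lparr>
     verts = verts \<Sigma>\<^sub>1 \<times> verts \<Sigma>\<^sub>2,
     edges = {{(u, v), (u', v)} | u u' v. {u, u'} \<in> edges \<Sigma>\<^sub>1 \<and> v \<in> verts \<Sigma>\<^sub>2} \<union>
             {{(u, v), (u, v')} | u v v'. u \<in> verts \<Sigma>\<^sub>1 \<and> {v, v'} \<in> edges \<Sigma>\<^sub>2},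
     esign = (\<lambda>e. if is_singleton (snd ` e) then esign \<Sigma>\<^sub>1 (fst ` e) else esign \<Sigma>\<^sub>2 (snd ` e))\<rparr>"

lemma esign_sprod:
  shows "esign (\<Sigma>\<^sub>1 \<box> \<Sigma>\<^sub>2) {(u, v), (u', v)} = esign \<Sigma>\<^sub>1 {u, u'}"
    and "v \<noteq> v' \<Longrightarrow> esign (\<Sigma>\<^sub>1 \<box> \<Sigma>\<^sub>2) {(u, v), (u, v')} = esign \<Sigma>\<^sub>2 {v, v'}"
  by (auto simp: sprod_def is_singleton_def)

lemma signed_graph_sprod:
  assumes "signed_graph \<Sigma>\<^sub>1" "signed_graph \<Sigma>\<^sub>2"
  shows "signed_graph (\<Sigma>\<^sub>1 \<box> \<Sigma>\<^sub>2)"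
proof -
  have A: "u \<in> verts \<Sigma>\<^sub>1 \<and> u' \<in> verts \<Sigma>\<^sub>1 \<and> u \<noteq> u' \<and> esign \<Sigma>\<^sub>1 {u, u'} \<in> {1, -1}"
    if "{u, u'} \<in> edges \<Sigma>\<^sub>1" for u u'
    using assms(1) that unfolding signed_graph_def by (fastforce simp: doubleton_eq_iff)
  have B: "v \<in> verts \<Sigma>\<^sub>2 \<and> v' \<in> verts \<Sigma>\<^sub>2 \<and> v \<noteq> v' \<and> esign \<Sigma>\<^sub>2 {v, v'} \<in> {1, -1}"
    if "{v, v'} \<in> edges \<Sigma>\<^sub>2" for v v'
    using assms(2) that unfolding signed_graph_def by (fastforce simp: doubleton_eq_iff)
  have V: "verts (\<Sigma>\<^sub>1 \<box> \<Sigma>\<^sub>2) = verts \<Sigma>\<^sub>1 \<times> verts \<Sigma>\<^sub>2"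
    by (simp add: sprod_def)
  have "e \<in> {{p, q} | p q. p \<in> verts (\<Sigma>\<^sub>1 \<box> \<Sigma>\<^sub>2) \<and> q \<in> verts (\<Sigma>\<^sub>1 \<box> \<Sigma>\<^sub>2) \<and> p \<noteq> q} \<and>
      esign (\<Sigma>\<^sub>1 \<box> \<Sigma>\<^sub>2) e \<in> {1, -1}" if e: "e \<in> edges (\<Sigma>\<^sub>1 \<box> \<Sigma>\<^sub>2)" for e
  proof -
    consider (1) u u' v where "e = {(u, v), (u', v)}" "{u, u'} \<in> edges \<Sigma>\<^sub>1" "v \<in> verts \<Sigma>\<^sub>2"
      | (2) u v v' where "e = {(u, v), (u, v')}" "u \<in> verts \<Sigma>\<^sub>1" "{v, v'} \<in> edges \<Sigma>\<^sub>2"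
      using e by (auto simp: sprod_def)
    then show ?thesis
    proof cases
      case 1
      with A[OF 1(2)] show ?thesis unfolding V by (fastforce simp: esign_sprod)
    next
      case 2
      with B[OF 2(3)] show ?thesis unfolding V by (fastforce simp: esign_sprod)
    qed
  qed
  then show ?thesis unfolding signed_graph_def by blast
qed

end

theory Submission
  imports Defs
begin

text \<open>Up to switching by signs, the closing edge of an unbalanced cycle is its only negative one.
  Balancing the product therefore means to find a grid of vectors in which neighbours have
  positive inner product, while the two ends of each row and of each column have negative inner
  product.

  The nonzero elements of \<open>\<Omega>\<^sup>2\<close> point in the eight directions that are multiples of 45 degrees,
  and an inner product is positive precisely for directions at most 45 degrees apart. Three steps
  can thus turn a vector by 135 degrees, which makes the inner product negative, but two steps
  cannot: in dimension 2 an unbalanced cycle can be balanced if its length is at least 4, but not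
  if it is a triangle. Adding the angles assigned to the two coordinates handles the product.
  In dimension 3 there is a 3 by 3 grid with the required signs (found by a computer search), and
  repeating its last row and column covers all longer cycles. In dimension 1 not even a single
  unbalanced cycle can be balanced.\<close>

section \<open>Balancing maps and their restriction to the factors of a product\<close>

definition balancing_map :: "nat \<Rightarrow> 'a sgraph \<Rightarrow> ('a \<Rightarrow> real vec) \<Rightarrow> bool" where
  "balancing_map k \<Sigma> \<zeta> \<longleftrightarrow> (\<forall>v\<in>verts \<Sigma>. \<zeta> v \<in> Omega k) \<and>
     (\<forall>u v. {u, v} \<in> edges \<Sigma> \<longrightarrow> esign \<Sigma> {u, v} * (\<zeta> u \<bullet> \<zeta> v) > 0)"

lemma Omega_carrier: "x \<in> Omega k \<Longrightarrow> x \<in> carrier_vec k"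
  by (simp add: Omega_def)

lemma smult_Omega:
  assumes "x \<in> Omega k" "a \<in> {1, -1}"
  shows "a \<cdot>\<^sub>v x \<in> Omega k"
  using assms by (fastforce simp: Omega_def)

lemma signed_graph_edgeD:
  assumes "signed_graph \<Sigma>" "{u, v} \<in> edges \<Sigma>"
  shows "u \<in> verts \<Sigma>" "v \<in> verts \<Sigma>" "u \<noteq> v" "esign \<Sigma> {u, v} \<in> {1, -1}"
  using assms unfolding signed_graph_def by (fastforce simp: doubleton_eq_iff)+

lemma sign_mult_sgn_eq_1_iff:
  fixes s x :: real
  assumes "s \<in> {1, -1}"
  shows "s * sgn x = 1 \<longleftrightarrow> s * x > 0"
  using assms by (auto simp: sgn_if)

text \<open>As edge signs are 1 or -1, one strict inequality says both that the inner product is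
  nonzero and that its sign agrees with that of the edge. This removes \<open>sgn\<close> and the
  definite description in \<open>edge_inner\<close> from all later arguments.\<close>

lemma balancing_map_iff:
  assumes "signed_graph \<Sigma>"
  shows "switching_function k \<Sigma> \<zeta> \<and> all_positive (switched \<Sigma> \<zeta>) \<longleftrightarrow> balancing_map k \<Sigma> \<zeta>"
proof (cases "\<forall>v\<in>verts \<Sigma>. \<zeta> v \<in> Omega k")
  case True
  have edge: "esign (switched \<Sigma> \<zeta>) {u, v} = 1 \<longleftrightarrow> esign \<Sigma> {u, v} * (\<zeta> u \<bullet> \<zeta> v) > 0"
    if "{u, v} \<in> edges \<Sigma>" for u v
  proof -
    note uv = signed_graph_edgeD[OF assms that]
    have "edge_inner \<zeta> {u, v} = \<zeta> u \<bullet> \<zeta> v"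
      using True uv(1,2) Omega_carrier by (blast intro: edge_inner_eq)
    then show ?thesis
      using sign_mult_sgn_eq_1_iff[OF uv(4)] by (simp add: switched_def)
  qed
  have "all_positive (switched \<Sigma> \<zeta>) \<longleftrightarrow>
      (\<forall>u v. {u, v} \<in> edges \<Sigma> \<longrightarrow> esign (switched \<Sigma> \<zeta>) {u, v} = 1)"
  proof -
    have "\<exists>u v. e = {u, v}" if "e \<in> edges \<Sigma>" for e
      using assms that unfolding signed_graph_def by blast
    moreover have "edges (switched \<Sigma> \<zeta>) = edges \<Sigma>"
      by (simp add: switched_def)
    ultimately show ?thesis
      unfolding all_positive_def by metis
  qed
  then show ?thesis
    using True edge unfolding switching_function_def balancing_map_def by fastforce
qed (auto simp: switching_function_def balancing_map_def)

lemma bdim_eq_Least: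
  assumes "signed_graph \<Sigma>"
  shows "bdim \<Sigma> = (LEAST k. k \<ge> 1 \<and> (\<exists>\<zeta>. balancing_map k \<Sigma> \<zeta>))"
  unfolding bdim_def balancing_map_iff[OF assms] ..

text \<open>Fixing one coordinate gives a copy of the other factor with its signs, so an obstruction
  in a factor obstructs the product.\<close>

lemma balancing_map_sprod_fst:
  assumes "v \<in> verts \<Sigma>\<^sub>2" "balancing_map k (\<Sigma>\<^sub>1 \<box> \<Sigma>\<^sub>2) \<zeta>"
  shows "balancing_map k \<Sigma>\<^sub>1 (\<lambda>u. \<zeta> (u, v))"
  unfolding balancing_map_def
proof (intro conjI allI impI ballI)
  fix u assume "u \<in> verts \<Sigma>\<^sub>1"
  then show "\<zeta> (u, v) \<in> Omega k"
    using assms by (auto simp: balancing_map_def sprod_def)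
next
  fix u u' assume "{u, u'} \<in> edges \<Sigma>\<^sub>1"
  then have "{(u, v), (u', v)} \<in> edges (\<Sigma>\<^sub>1 \<box> \<Sigma>\<^sub>2)"
    using assms(1) by (auto simp: sprod_def)
  then show "esign \<Sigma>\<^sub>1 {u, u'} * (\<zeta> (u, v) \<bullet> \<zeta> (u', v)) > 0"
    using assms(2) by (metis balancing_map_def esign_sprod(1))
qed

text \<open>The second factor must be loopless here: on a set with a singleton second projection,
  \<open>esign\<close> of the product reads the sign from the first factor.\<close>

lemma balancing_map_sprod_snd:
  assumes "signed_graph \<Sigma>\<^sub>2" "u \<in> verts \<Sigma>\<^sub>1" "balancing_map k (\<Sigma>\<^sub>1 \<box> \<Sigma>\<^sub>2) \<zeta>"
  shows "balancing_map k \<Sigma>\<^sub>2 (\<lambda>v. \<zeta> (u, v))"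
  unfolding balancing_map_def
proof (intro conjI allI impI ballI)
  fix v assume "v \<in> verts \<Sigma>\<^sub>2"
  then show "\<zeta> (u, v) \<in> Omega k"
    using assms(2,3) by (auto simp: balancing_map_def sprod_def)
next
  fix v v' assume e: "{v, v'} \<in> edges \<Sigma>\<^sub>2"
  then have "{(u, v), (u, v')} \<in> edges (\<Sigma>\<^sub>1 \<box> \<Sigma>\<^sub>2)"
    using assms(2) by (auto simp: sprod_def)
  then show "esign \<Sigma>\<^sub>2 {v, v'} * (\<zeta> (u, v) \<bullet> \<zeta> (u, v')) > 0"
    using assms(3) signed_graph_edgeD(3)[OF assms(1) e]
    by (metis balancing_map_def esign_sprod(2))
qed

section \<open>Unbalanced cycles up to switching by signs\<close>

text \<open>Take for \<open>t i\<close> the product of the first \<open>i\<close> edge signs along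
  the cycle. Each path edge then has sign \<open>t i * t (Suc i)\<close>, and the total product -1
  puts the only defect on the closing edge.\<close>

lemma unbalanced_cycle_normal_form:
  fixes \<Sigma> :: "'a sgraph"
  assumes "unbalanced_signed_cycle m \<Sigma>" "m \<ge> 3"
  obtains c :: "nat \<Rightarrow> 'a" and t :: "nat \<Rightarrow> real" where
    "bij_betw c {..<m} (verts \<Sigma>)"
    "edges \<Sigma> = insert {c 0, c (m - 1)} {{c i, c (Suc i)} | i. Suc i < m}"
    "\<And>i. i < m \<Longrightarrow> t i \<in> {1, -1}"
    "\<And>i. Suc i < m \<Longrightarrow> esign \<Sigma> {c i, c (Suc i)} = t i * t (Suc i)"
    "esign \<Sigma> {c 0, c (m - 1)} = - (t 0 * t (m - 1))"
proof -
  from assms obtain c where c: "bij_betw c {..<m} (verts \<Sigma>)"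
    and E: "edges \<Sigma> = {{c i, c (Suc i mod m)} | i. i < m}"
    and sg: "signed_graph \<Sigma>" and prod: "(\<Prod>e\<in>edges \<Sigma>. esign \<Sigma> e) = -1"
    unfolding unbalanced_signed_cycle_def is_cycle_graph_def by blast
  define e where "e i = {c i, c (Suc i mod m)}" for i
  have Ee: "edges \<Sigma> = e ` {..<m}"
    unfolding E e_def by auto
  have inj_c: "c i = c j \<longleftrightarrow> i = j" if "i < m" "j < m" for i j
    using c that by (auto simp: bij_betw_def inj_on_def)
  \<comment> \<open>Two indices giving the same edge in opposite orientations would force
    \<open>m\<close> to divide 2. Injectivity turns the product over the edge set into a product
    over indices.\<close>
  have "inj_on e {..<m}"
  proof (rule inj_onI)
    fix i j assume ij: "i \<in> {..<m}" "j \<in> {..<m}" and "e i = e j"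
    then have "i = j \<or> i = Suc j mod m \<and> Suc i mod m = j"
      using assms(2) inj_c by (auto simp: e_def doubleton_eq_iff)
    then show "i = j"
      using ij assms(2) by (auto simp: mod_Suc split: if_splits)
  qed
  then have prod_e: "(\<Prod>i<m. esign \<Sigma> (e i)) = -1"
    using prod by (simp add: Ee prod.reindex)
  have sign_e: "esign \<Sigma> (e i) \<in> {1, -1}" if "i < m" for i
    using sg that Ee unfolding signed_graph_def by blast
  define t where "t i = (\<Prod>j<i. esign \<Sigma> (e j))" for i
  have t: "t i \<in> {1, -1}" if "i \<le> m" for i
    using that
  proof (induction i)
    case (Suc i)
    then show ?case using sign_e[of i] by (auto simp: t_def)
  qed (simp add: t_def)
  have t_Suc: "t (Suc i) = t i * esign \<Sigma> (e i)" for i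
    by (simp add: t_def)
  have last: "e (m - 1) = {c 0, c (m - 1)}"
    using assms(2) by (auto simp: e_def)
  have e_Suc: "e i = {c i, c (Suc i)}" if "Suc i < m" for i
    using that by (simp add: e_def)
  show thesis
  proof (rule that[of c t])
    show "bij_betw c {..<m} (verts \<Sigma>)" by fact
    have "{..<m} = insert (m - 1) {i. Suc i < m}"
      using assms(2) by auto
    then show "edges \<Sigma> = insert {c 0, c (m - 1)} {{c i, c (Suc i)} | i. Suc i < m}"
      unfolding Ee using last e_Suc by auto
    show "t i \<in> {1, -1}" if "i < m" for i
      using t that by simp
    show "esign \<Sigma> {c i, c (Suc i)} = t i * t (Suc i)" if "Suc i < m" for i
      using t[of i] that t_Suc[of i] e_Suc[OF that] by auto
    have "t (m - 1) * esign \<Sigma> (e (m - 1)) = -1"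
      using prod_e t_Suc[of "m - 1"] assms(2) by (simp add: t_def)
    moreover have "t 0 = 1" by (simp add: t_def)
    ultimately show "esign \<Sigma> {c 0, c (m - 1)} = - (t 0 * t (m - 1))"
      using t[of "m - 1"] last by auto
  qed
qed

text \<open>Here \<open>p\<close> is the position on the cycle and \<open>s\<close> the switching
  sign. The sequence \<open>f\<close> is quantified inside the conclusion because the same
  \<open>p\<close> and \<open>s\<close> must serve every row, or every column, of a grid.\<close>

lemma unbalanced_cycle_labelling:
  fixes \<Sigma> :: "'a sgraph"
  assumes "unbalanced_signed_cycle m \<Sigma>" "m \<ge> 3"
  obtains p :: "'a \<Rightarrow> nat" and s :: "'a \<Rightarrow> real" where
    "\<And>v. v \<in> verts \<Sigma> \<Longrightarrow> s v \<in> {1, -1}"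
    "\<And>k f u v. \<lbrakk>\<And>i. f i \<in> carrier_vec k; \<And>i. f i \<bullet> f (Suc i) > 0; f 0 \<bullet> f (m - 1) < 0;
       {u, v} \<in> edges \<Sigma>\<rbrakk> \<Longrightarrow> esign \<Sigma> {u, v} * s u * s v * (f (p u) \<bullet> f (p v)) > 0"
proof -
  obtain c t where c: "bij_betw c {..<m} (verts \<Sigma>)"
    and E: "edges \<Sigma> = insert {c 0, c (m - 1)} {{c i, c (Suc i)} | i. Suc i < m}"
    and t: "\<And>i. i < m \<Longrightarrow> t i \<in> {1, -1 :: real}"
    and sgn_Suc: "\<And>i. Suc i < m \<Longrightarrow> esign \<Sigma> {c i, c (Suc i)} = t i * t (Suc i)"
    and sgn_last: "esign \<Sigma> {c 0, c (m - 1)} = - (t 0 * t (m - 1))"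
    using unbalanced_cycle_normal_form[OF assms] by blast
  define p where "p = inv_into {..<m} c"
  have p_c: "p (c i) = i" if "i < m" for i
    using c that by (simp add: p_def bij_betw_def)
  show thesis
  proof (rule that[of "t \<circ> p" p])
    show "(t \<circ> p) v \<in> {1, -1}" if "v \<in> verts \<Sigma>" for v
    proof -
      obtain i where "i < m" "v = c i"
        using c \<open>v \<in> verts \<Sigma>\<close> by (auto simp: bij_betw_def)
      then show ?thesis using t[of i] p_c by simp
    qed
    fix k u v and f :: "nat \<Rightarrow> real vec"
    assume f: "\<And>i. f i \<in> carrier_vec k" and f_Suc: "\<And>i. f i \<bullet> f (Suc i) > 0"
      and f_last: "f 0 \<bullet> f (m - 1) < 0" and "{u, v} \<in> edges \<Sigma>"
    \<comment> \<open>The quantity to be shown positive is symmetric in its arguments, so each edge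
      may be checked in the orientation listed in the normal form.\<close>
    define g where "g x y = esign \<Sigma> {x, y} * (t \<circ> p) x * (t \<circ> p) y * (f (p x) \<bullet> f (p y))" for x y
    have g_comm: "g x y = g y x" for x y
      using comm_scalar_prod[OF f[of "p x"] f[of "p y"]] by (simp add: g_def insert_commute mult_ac)
    have g_c: "g (c i) (c j) = esign \<Sigma> {c i, c j} * (t i * t j) * (f i \<bullet> f j)" if "i < m" "j < m" for i j
      using p_c that by (simp add: g_def)
    have sq: "t i * t j * (t i * t j) = 1" if "i < m" "j < m" for i j
      using t[OF that(1)] t[OF that(2)] by auto
    have g_Suc: "g (c i) (c (Suc i)) > 0" if "Suc i < m" for i
      using that sgn_Suc[OF that] sq[of i "Suc i"] f_Suc[of i] by (simp add: g_c)
    have g_last: "g (c 0) (c (m - 1)) > 0"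
      using assms(2) sgn_last sq[of 0 "m - 1"] f_last by (simp add: g_c)
    obtain x y where "{u, v} = {x, y}" and "g x y > 0"
      using \<open>{u, v} \<in> edges \<Sigma>\<close> g_Suc g_last unfolding E by blast
    then have "g u v > 0"
      by (metis doubleton_eq_iff g_comm)
    then show "esign \<Sigma> {u, v} * (t \<circ> p) u * (t \<circ> p) v * (f (p u) \<bullet> f (p v)) > 0"
      by (simp add: g_def)
  qed
qed

section \<open>From grids of vectors to balancing maps of the product\<close>

text \<open>The witness scales \<open>F (p u) (q v)\<close> by \<open>s u * t v\<close>. Along an
  edge of one factor, the sign from the other factor occurs squared and cancels, which leaves the
  claim for a single row or column of \<open>F\<close>.\<close>

lemma balancing_map_sprod:
  assumes "unbalanced_signed_cycle m \<Sigma>\<^sub>1" "m \<ge> 3" "unbalanced_signed_cycle n \<Sigma>\<^sub>2" "n \<ge> 3"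
    and F: "\<And>i j. F i j \<in> Omega k"
    and F_fst: "\<And>i j. F i j \<bullet> F (Suc i) j > 0" "\<And>j. F 0 j \<bullet> F (m - 1) j < 0"
    and F_snd: "\<And>i j. F i j \<bullet> F i (Suc j) > 0" "\<And>i. F i 0 \<bullet> F i (n - 1) < 0"
  shows "\<exists>\<zeta>. balancing_map k (\<Sigma>\<^sub>1 \<box> \<Sigma>\<^sub>2) \<zeta>"
proof -
  obtain p s where s: "\<And>v. v \<in> verts \<Sigma>\<^sub>1 \<Longrightarrow> s v \<in> {1, -1 :: real}"
    and p: "\<And>k f u v. \<lbrakk>\<And>i. f i \<in> carrier_vec k; \<And>i. f i \<bullet> f (Suc i) > 0; f 0 \<bullet> f (m - 1) < 0;
       {u, v} \<in> edges \<Sigma>\<^sub>1\<rbrakk> \<Longrightarrow> esign \<Sigma>\<^sub>1 {u, v} * s u * s v * (f (p u :: nat) \<bullet> f (p v)) > 0"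
    using unbalanced_cycle_labelling[OF assms(1,2)] by metis
  obtain q t where t: "\<And>v. v \<in> verts \<Sigma>\<^sub>2 \<Longrightarrow> t v \<in> {1, -1 :: real}"
    and q: "\<And>k f u v. \<lbrakk>\<And>i. f i \<in> carrier_vec k; \<And>i. f i \<bullet> f (Suc i) > 0; f 0 \<bullet> f (n - 1) < 0;
       {u, v} \<in> edges \<Sigma>\<^sub>2\<rbrakk> \<Longrightarrow> esign \<Sigma>\<^sub>2 {u, v} * t u * t v * (f (q u :: nat) \<bullet> f (q v)) > 0"
    using unbalanced_cycle_labelling[OF assms(3,4)] by metis
  have sg: "signed_graph \<Sigma>\<^sub>1" "signed_graph \<Sigma>\<^sub>2"
    using assms(1,3) by (simp_all add: unbalanced_signed_cycle_def)
  have F_carrier: "F i j \<in> carrier_vec k" for i j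
    by (rule Omega_carrier[OF F])
  define \<zeta> where "\<zeta> = (\<lambda>(u, v). (s u * t v) \<cdot>\<^sub>v F (p u) (q v))"
  have inner: "\<zeta> (u, v) \<bullet> \<zeta> (u', v') = s u * t v * s u' * t v' * (F (p u) (q v) \<bullet> F (p u') (q v'))"
    for u v u' v'
    using F_carrier[of "p u" "q v"] F_carrier[of "p u'" "q v'"] by (simp add: \<zeta>_def)
  have fst_pos: "esign \<Sigma>\<^sub>1 {u, u'} * (\<zeta> (u, v) \<bullet> \<zeta> (u', v)) > 0"
    if "{u, u'} \<in> edges \<Sigma>\<^sub>1" "v \<in> verts \<Sigma>\<^sub>2" for u u' v
    using p[where f = "\<lambda>i. F i (q v)", OF F_carrier F_fst that(1)] t[OF that(2)] by (auto simp: inner mult_ac)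
  have snd_pos: "esign \<Sigma>\<^sub>2 {v, v'} * (\<zeta> (u, v) \<bullet> \<zeta> (u, v')) > 0"
    if "{v, v'} \<in> edges \<Sigma>\<^sub>2" "u \<in> verts \<Sigma>\<^sub>1" for u v v'
    using q[where f = "\<lambda>j. F (p u) j", OF F_carrier F_snd that(1)] s[OF that(2)] by (auto simp: inner mult_ac)
  have "balancing_map k (\<Sigma>\<^sub>1 \<box> \<Sigma>\<^sub>2) \<zeta>"
    unfolding balancing_map_def
  proof (intro conjI allI impI ballI)
    fix w assume "w \<in> verts (\<Sigma>\<^sub>1 \<box> \<Sigma>\<^sub>2)"
    then obtain u v where w: "w = (u, v)" "u \<in> verts \<Sigma>\<^sub>1" "v \<in> verts \<Sigma>\<^sub>2"
      by (auto simp: sprod_def)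
    then have "s u * t v \<in> {1, -1}" using s[of u] t[of v] by auto
    then show "\<zeta> w \<in> Omega k"
      using smult_Omega[OF F] w(1) by (simp add: \<zeta>_def)
  next
    fix w w' assume "{w, w'} \<in> edges (\<Sigma>\<^sub>1 \<box> \<Sigma>\<^sub>2)"
    then consider u u' v where "w = (u, v)" "w' = (u', v)" "{u, u'} \<in> edges \<Sigma>\<^sub>1" "v \<in> verts \<Sigma>\<^sub>2"
      | u v v' where "w = (u, v)" "w' = (u, v')" "u \<in> verts \<Sigma>\<^sub>1" "{v, v'} \<in> edges \<Sigma>\<^sub>2"
      by (auto simp: sprod_def doubleton_eq_iff) (metis insert_commute)+
    then show "esign (\<Sigma>\<^sub>1 \<box> \<Sigma>\<^sub>2) {w, w'} * (\<zeta> w \<bullet> \<zeta> w') > 0"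
    proof cases
      case 1
      then show ?thesis using fst_pos by (simp add: esign_sprod)
    next
      case 2
      then show ?thesis
        using snd_pos signed_graph_edgeD(3)[OF sg(2) 2(4)] by (simp add: esign_sprod)
    qed
  qed
  then show ?thesis by blast
qed

section \<open>Explicit grids in dimensions 2 and 3\<close>

lemma vec_of_list_Omega:
  assumes "length xs = k" "set xs \<subseteq> {-1, 0, 1}"
  shows "vec_of_list xs \<in> Omega k"
proof -
  have "vec_of_list xs $ i \<in> {-1, 0, 1}" if "i < k" for i
    using assms that nth_mem[of i xs] by (metis subsetD vec_of_list_index)
  moreover have "vec_of_list xs \<in> carrier_vec k"
    using assms(1) by (intro carrier_vecI) simp
  ultimately show ?thesis
    unfolding Omega_def by blast
qed

text \<open>Direction at \<open>d\<close> times 45 degrees. Seven entries suffice, since a sum of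
  two angles of at most three steps each is at most six steps.\<close>

definition octant_dir :: "nat \<Rightarrow> real vec" where
  "octant_dir d = vec_of_list ([[1,0], [1,1], [0,1], [-1,1], [-1,0], [-1,-1], [0,-1]] ! d)"

lemma octant_dir_Omega: "d \<le> 6 \<Longrightarrow> octant_dir d \<in> Omega 2"
proof -
  assume "d \<le> 6"
  then have "d = 0 \<or> d = 1 \<or> d = 2 \<or> d = 3 \<or> d = 4 \<or> d = 5 \<or> d = 6"
    by presburger
  then show ?thesis
    unfolding octant_dir_def by (elim disjE) (auto intro!: vec_of_list_Omega simp del: vec_of_list_Cons)
qed

lemma octant_dir_inner:
  "d \<le> 6 \<Longrightarrow> octant_dir d \<bullet> octant_dir d > 0"
  "d < 6 \<Longrightarrow> octant_dir d \<bullet> octant_dir (Suc d) > 0"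
  "d \<le> 3 \<Longrightarrow> octant_dir d \<bullet> octant_dir (d + 3) < 0"
proof -
  have "d = 0 \<or> d = 1 \<or> d = 2 \<or> d = 3 \<or> d = 4 \<or> d = 5 \<or> d = 6" if "d \<le> 6"
    using that by presburger
  then show "d \<le> 6 \<Longrightarrow> octant_dir d \<bullet> octant_dir d > 0"
    by (auto simp: octant_dir_def)
  have "d = 0 \<or> d = 1 \<or> d = 2 \<or> d = 3 \<or> d = 4 \<or> d = 5" if "d < 6"
    using that by presburger
  then show "d < 6 \<Longrightarrow> octant_dir d \<bullet> octant_dir (Suc d) > 0"
    by (auto simp: octant_dir_def)
  have "d = 0 \<or> d = 1 \<or> d = 2 \<or> d = 3" if "d \<le> 3"
    using that by presburger
  then show "d \<le> 3 \<Longrightarrow> octant_dir d \<bullet> octant_dir (d + 3) < 0"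
    by (auto simp: octant_dir_def)
qed

lemma balancing_map_2_exists:
  assumes "unbalanced_signed_cycle m \<Sigma>\<^sub>1" "m > 3" "unbalanced_signed_cycle n \<Sigma>\<^sub>2" "n > 3"
  shows "\<exists>\<zeta>. balancing_map 2 (\<Sigma>\<^sub>1 \<box> \<Sigma>\<^sub>2) \<zeta>"
proof (rule balancing_map_sprod[where F = "\<lambda>i j. octant_dir (min i 3 + min j 3)"])
  \<comment> \<open>The angle grows by one step up to index 3 and then stays constant, so neighbours
    are 0 or 45 degrees apart.\<close>
  have min_Suc: "min (Suc i) 3 = min i 3 \<or> min (Suc i) 3 = Suc (min i 3) \<and> min i 3 < 3" for i
    by auto
  show "octant_dir (min i 3 + min j 3) \<in> Omega 2" for i j
    by (rule octant_dir_Omega) simp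
  show "octant_dir (min i 3 + min j 3) \<bullet> octant_dir (min (Suc i) 3 + min j 3) > 0" for i j
    using min_Suc[of i] by (auto simp del: min_Suc_numeral intro!: octant_dir_inner)
  show "octant_dir (min i 3 + min j 3) \<bullet> octant_dir (min i 3 + min (Suc j) 3) > 0" for i j
    using min_Suc[of j] by (auto simp del: min_Suc_numeral intro!: octant_dir_inner)
  \<comment> \<open>As \<open>m - 1\<close> is at least 3, the ends differ by the full 135
    degrees.\<close>
  show "octant_dir (min 0 3 + min j 3) \<bullet> octant_dir (min (m - 1) 3 + min j 3) < 0" for j
    using octant_dir_inner(3)[of "min j 3"] assms(2) by (simp add: add.commute)
  show "octant_dir (min i 3 + min 0 3) \<bullet> octant_dir (min i 3 + min (n - 1) 3) < 0" for i
    using octant_dir_inner(3)[of "min i 3"] assms(4) by simp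
qed (use assms in auto)

text \<open>Vectors with entries 1 and -1 that differ in \<open>d\<close> of 3 coordinates have
  inner product \<open>3 - 2 * d\<close>. Adjacent table entries differ in one coordinate and the
  ends of a row in two; the table is symmetric, so columns behave alike. The \<open>min\<close>
  repeats the last row and column.\<close>

definition table3 :: "nat \<Rightarrow> nat \<Rightarrow> real vec" where
  "table3 i j = vec_of_list
    ([[[1, 1, 1], [1, 1, -1], [1, -1, -1]],
      [[1, 1, -1], [1, 1, 1], [1, -1, 1]],
      [[1, -1, -1], [1, -1, 1], [1, 1, 1]]] ! min i 2 ! min j 2)"

lemma balancing_map_3_exists:
  assumes "unbalanced_signed_cycle m \<Sigma>\<^sub>1" "m \<ge> 3" "unbalanced_signed_cycle n \<Sigma>\<^sub>2" "n \<ge> 3"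
  shows "\<exists>\<zeta>. balancing_map 3 (\<Sigma>\<^sub>1 \<box> \<Sigma>\<^sub>2) \<zeta>"
proof (rule balancing_map_sprod[where F = table3])
  have cases3: "i = 0 \<or> i = Suc 0 \<or> (\<exists>i'. i = Suc (Suc i'))" for i
    by (metis not0_implies_Suc)
  have ends: "min (m - 1) 2 = 2" "min (n - 1) 2 = 2"
    using assms by auto
  show "table3 i j \<in> Omega 3" for i j
    unfolding table3_def using cases3[of i] cases3[of j]
    by (intro vec_of_list_Omega) (auto simp: numeral_eq_Suc)
  show "table3 i j \<bullet> table3 (Suc i) j > 0" for i j
    using cases3[of i] cases3[of j] by (auto simp: table3_def numeral_eq_Suc)
  show "table3 i j \<bullet> table3 i (Suc j) > 0" for i j
    using cases3[of i] cases3[of j] by (auto simp: table3_def numeral_eq_Suc)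
  show "table3 0 j \<bullet> table3 (m - 1) j < 0" for j
    using cases3[of j] unfolding table3_def ends by (auto simp: numeral_eq_Suc)
  show "table3 i 0 \<bullet> table3 i (n - 1) < 0" for i
    using cases3[of i] unfolding table3_def ends by (auto simp: numeral_eq_Suc)
qed (use assms in auto)

section \<open>Obstructions in dimensions 1 and 2\<close>

text \<open>Rescaling the vectors by the signs \<open>t\<close> of the normal form moves all
  negativity to the closing pair.\<close>

lemma unbalanced_cycle_balancing_sequence:
  assumes "unbalanced_signed_cycle m \<Sigma>" "m \<ge> 3" "balancing_map k \<Sigma> \<zeta>"
  obtains y where "\<And>i. i < m \<Longrightarrow> y i \<in> Omega k" "\<And>i. Suc i < m \<Longrightarrow> y i \<bullet> y (Suc i) > 0"
    "y 0 \<bullet> y (m - 1) < 0"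
proof -
  obtain c t where c: "bij_betw c {..<m} (verts \<Sigma>)"
    and E: "edges \<Sigma> = insert {c 0, c (m - 1)} {{c i, c (Suc i)} | i. Suc i < m}"
    and t: "\<And>i. i < m \<Longrightarrow> t i \<in> {1, -1 :: real}"
    and sgn_Suc: "\<And>i. Suc i < m \<Longrightarrow> esign \<Sigma> {c i, c (Suc i)} = t i * t (Suc i)"
    and sgn_last: "esign \<Sigma> {c 0, c (m - 1)} = - (t 0 * t (m - 1))"
    using unbalanced_cycle_normal_form[OF assms(1,2)] by blast
  define y where "y i = t i \<cdot>\<^sub>v \<zeta> (c i)" for i
  have \<zeta>: "\<zeta> (c i) \<in> Omega k" if "i < m" for i
    using c that assms(3) by (auto simp: balancing_map_def bij_betw_def)
  have inner: "y i \<bullet> y j = t i * t j * (\<zeta> (c i) \<bullet> \<zeta> (c j))" if "i < m" "j < m" for i j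
    using Omega_carrier[OF \<zeta>[OF that(1)]] Omega_carrier[OF \<zeta>[OF that(2)]] by (simp add: y_def)
  have pos: "esign \<Sigma> {u, v} * (\<zeta> u \<bullet> \<zeta> v) > 0" if "{u, v} \<in> edges \<Sigma>" for u v
    using assms(3) that by (simp add: balancing_map_def)
  show thesis
  proof (rule that[of y])
    show "y i \<in> Omega k" if "i < m" for i
      unfolding y_def by (rule smult_Omega[OF \<zeta> t]) (use that in auto)
    show "y i \<bullet> y (Suc i) > 0" if "Suc i < m" for i
      using pos[of "c i" "c (Suc i)"] that sgn_Suc[OF that] inner[of i "Suc i"] unfolding E by auto
    show "y 0 \<bullet> y (m - 1) < 0"
      using pos[of "c 0" "c (m - 1)"] sgn_last inner[of 0 "m - 1"] assms(2) unfolding E by auto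
  qed
qed

text \<open>In dimension 1 the inner product is a product of two reals, so the sign of
  \<open>y 0\<close> propagates along the sequence to its last term.\<close>

lemma no_balancing_map_1:
  assumes "unbalanced_signed_cycle m \<Sigma>" "m \<ge> 3"
  shows "\<not> balancing_map 1 \<Sigma> \<zeta>"
proof
  assume "balancing_map 1 \<Sigma> \<zeta>"
  obtain y where y: "\<And>i. i < m \<Longrightarrow> y i \<in> Omega 1"
    and y_Suc: "\<And>i. Suc i < m \<Longrightarrow> y i \<bullet> y (Suc i) > 0" and y_last: "y 0 \<bullet> y (m - 1) < 0"
    using unbalanced_cycle_balancing_sequence[OF assms \<open>balancing_map 1 \<Sigma> \<zeta>\<close>] by blast
  have inner: "y i \<bullet> y j = y i $ 0 * y j $ 0" if "i < m" "j < m" for i j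
    using y that by (fastforce simp: Omega_def scalar_prod_def)
  have "y 0 $ 0 * y (Suc i) $ 0 > 0" if "Suc i < m" for i
    using that
  proof (induction i)
    case 0
    then show ?case using y_Suc[of 0] inner[of 0 "Suc 0"] by simp
  next
    case (Suc i)
    then have "y 0 $ 0 * y (Suc i) $ 0 > 0" "y (Suc i) $ 0 * y (Suc (Suc i)) $ 0 > 0"
      using y_Suc[of "Suc i"] inner[of "Suc i" "Suc (Suc i)"] by simp_all
    then show ?case by (auto simp: zero_less_mult_iff)
  qed
  from this[of "m - 2"] y_last inner[of 0 "m - 1"] assms(2) show False
    by (simp add: Suc_diff_Suc numeral_2_eq_2)
qed

text \<open>Two turns of at most 45 degrees reach at most 90 degrees, where the inner product is
  still nonnegative. Stated in components, this is a finite check over all values in {-1, 0,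
  1}.\<close>

lemma no_triangle_in_Omega_2:
  fixes a\<^sub>0 a\<^sub>1 b\<^sub>0 b\<^sub>1 c\<^sub>0 c\<^sub>1 :: real
  assumes inner: "a\<^sub>0 * b\<^sub>0 + a\<^sub>1 * b\<^sub>1 > 0" "b\<^sub>0 * c\<^sub>0 + b\<^sub>1 * c\<^sub>1 > 0" "a\<^sub>0 * c\<^sub>0 + a\<^sub>1 * c\<^sub>1 < 0"
    and comp: "a\<^sub>0 \<in> {-1, 0, 1}" "a\<^sub>1 \<in> {-1, 0, 1}" "b\<^sub>0 \<in> {-1, 0, 1}" "b\<^sub>1 \<in> {-1, 0, 1}"
      "c\<^sub>0 \<in> {-1, 0, 1}" "c\<^sub>1 \<in> {-1, 0, 1}"
  shows False
  using comp unfolding insert_iff empty_iff simp_thms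
  using inner by (elim disjE) simp_all

lemma no_balancing_map_2_triangle:
  assumes "unbalanced_signed_cycle 3 \<Sigma>"
  shows "\<not> balancing_map 2 \<Sigma> \<zeta>"
proof
  assume "balancing_map 2 \<Sigma> \<zeta>"
  obtain y where y: "\<And>i. i < 3 \<Longrightarrow> y i \<in> Omega 2"
    and y_Suc: "\<And>i. Suc i < 3 \<Longrightarrow> y i \<bullet> y (Suc i) > 0" and y_last: "y 0 \<bullet> y (3 - 1) < 0"
    using unbalanced_cycle_balancing_sequence[OF assms _ \<open>balancing_map 2 \<Sigma> \<zeta>\<close>] by blast
  have inner: "y i \<bullet> y j = y i $ 0 * y j $ 0 + y i $ 1 * y j $ 1" if "i < 3" "j < 3" for i j
  proof -
    have "dim_vec (y j) = 2"
      using y[OF that(2)] by (simp add: Omega_def)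
    then show ?thesis
      by (simp add: scalar_prod_def sum.atLeast0_lessThan_Suc numeral_2_eq_2)
  qed
  have comp: "y i $ 0 \<in> {-1, 0, 1}" "y i $ 1 \<in> {-1, 0, 1}" if "i < 3" for i
    using y[OF that] by (auto simp: Omega_def)
  have "y 0 $ 0 * y 1 $ 0 + y 0 $ 1 * y 1 $ 1 > 0" "y 1 $ 0 * y 2 $ 0 + y 1 $ 1 * y 2 $ 1 > 0"
    "y 0 $ 0 * y 2 $ 0 + y 0 $ 1 * y 2 $ 1 < 0"
    using y_Suc[of 0] y_Suc[of 1] y_last by (simp_all add: inner numeral_2_eq_2)
  then show False
    by (rule no_triangle_in_Omega_2) (use comp in auto)
qed

section \<open>The balancing dimension of the product\<close>

theorem proposition2p5:
  fixes \<Sigma>\<^sub>1 :: "'a sgraph" and \<Sigma>\<^sub>2 :: "'b sgraph" and m n :: nat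
  assumes "m \<ge> 3" and "n \<ge> 3"
    and "unbalanced_signed_cycle m \<Sigma>\<^sub>1"
    and "unbalanced_signed_cycle n \<Sigma>\<^sub>2"
  shows "bdim (\<Sigma>\<^sub>1 \<box> \<Sigma>\<^sub>2) = (if m > 3 \<and> n > 3 then 2 else 3)"
proof -
  have sg: "signed_graph \<Sigma>\<^sub>1" "signed_graph \<Sigma>\<^sub>2"
    using assms by (simp_all add: unbalanced_signed_cycle_def)
  \<comment> \<open>Both cycles have vertices; these two select the copies of the factors to which
    the obstructions are applied.\<close>
  obtain u v where uv: "u \<in> verts \<Sigma>\<^sub>1" "v \<in> verts \<Sigma>\<^sub>2"
    using assms unfolding unbalanced_signed_cycle_def is_cycle_graph_def bij_betw_def
    by (metis imageI lessThan_iff less_le_trans zero_less_numeral)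
  have no1: "\<not> balancing_map 1 (\<Sigma>\<^sub>1 \<box> \<Sigma>\<^sub>2) \<zeta>" for \<zeta>
    using balancing_map_sprod_fst[OF uv(2)] no_balancing_map_1[OF assms(3,1)] by blast
  have no2: "\<not> balancing_map 2 (\<Sigma>\<^sub>1 \<box> \<Sigma>\<^sub>2) \<zeta>" if "\<not> (m > 3 \<and> n > 3)" for \<zeta>
  proof -
    from that assms(1,2) consider "m = 3" | "n = 3" by linarith
    then show ?thesis
    proof cases
      case 1
      then show ?thesis
        using balancing_map_sprod_fst[OF uv(2)] no_balancing_map_2_triangle assms(3) by blast
    next
      case 2
      then show ?thesis
        using balancing_map_sprod_snd[OF sg(2) uv(1)] no_balancing_map_2_triangle assms(4) by blast
    qed
  qed
  show ?thesis
    unfolding bdim_eq_Least[OF signed_graph_sprod[OF sg]]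
  proof (rule Least_equality)
    show "(if m > 3 \<and> n > 3 then 2 else 3) \<ge> (1::nat) \<and>
        (\<exists>\<zeta>. balancing_map (if m > 3 \<and> n > 3 then 2 else 3) (\<Sigma>\<^sub>1 \<box> \<Sigma>\<^sub>2) \<zeta>)"
      using balancing_map_2_exists[OF assms(3) _ assms(4)]
        balancing_map_3_exists[OF assms(3,1,4,2)] by simp
    fix k assume k: "k \<ge> 1 \<and> (\<exists>\<zeta>. balancing_map k (\<Sigma>\<^sub>1 \<box> \<Sigma>\<^sub>2) \<zeta>)"
    then have "k \<noteq> 1" "\<not> (m > 3 \<and> n > 3) \<Longrightarrow> k \<noteq> 2"
      using no1 no2 by auto
    with k show "(if m > 3 \<and> n > 3 then 2 else 3) \<le> k"
      by auto
  qed
qed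

end
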